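(* For complex parameters $\beta_1,\beta_2$ define the map $R(\beta_1,\beta_2):(x,y)\mapsto(p,q)$ by $$(p^1,p^2)=\big(y^1+y^2(1-P),\;y^2P\big),\qquad (q^1,q^2)=\big(x^1-y^2(1-P),\;x^2P^{-1}\big),\qquad P=\frac{y^2-x^1-\beta_2}{y^2-x^1-\beta_1}.$$ Then: (a) whenever $u,v,u_{(1)},u_{(2)},v_{(2)},u_{(1,2)},v_{(1,2)}$ satisfy $$u_{(1,2)}=u+(\beta_1-\beta_2)\frac{u+v_{(2)}}{u_{(1)}+v_{(2)}-\beta_1},\qquad v_{(1,2)}=v+(\beta_2-\beta_1)\frac{v+u_{(1)}}{u_{(1)}+v_{(2)}-\beta_2},$$ the quantities $x=(u-u_{(1)},\,v+u_{(1)})$, $y=(u_{(2)}-u,\,u+v_{(2)})$, $p=(u_{(2)}-u_{(1,2)},\,v_{(2)}+u_{(1,2)})$, $q=(u_{(1,2)}-u_{(1)},\,u_{(1)}+v_{(1,2)})$ satisfy $(p,q)=R(\beta_1,\beta_2)(x,y)$; (b) $R$ satisfies the parameter-dependent Yang-Baxter relation $$R^{(2,3)}(\beta_2,\beta_3)\,R^{(1,3)}(\beta_1,\beta_3)\,R^{(1,2)}(\beta_1,\beta_2)=R^{(1,2)}(\beta_1,\beta_2)\,R^{(1,3)}(\beta_1,\beta_3)\,R^{(2,3)}(\beta_2,\beta_3).$$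
   Context: Here $x=(x^1,x^2)$, etc.; upper indices on $x,y,p,q$ denote components, not powers (except $P^{-1}=1/P$). All variables are complex scalars; identities are understood for generic values, where all expressions are defined (equalities of rational maps). $R^{(i,j)}$ acts on triples $(x,y,z)$ of elements of $\mathbb{C}^2$ as $R$ on the $i$-th and $j$-th entries (in this order) and as the identity on the remaining entry; products are compositions. Subscripts in parentheses are just names for the (shifted) field values on the vertices of an elementary square. *)

theory Defs
  imports "HOL-Analysis.Analysis"
begin

type_synonym point = "complex \<times> complex"

definition P_factor :: "complex \<Rightarrow> complex \<Rightarrow> point \<Rightarrow> point \<Rightarrow> complex" where
  "P_factor b1 b2 x y = (snd y - fst x - b2) / (snd y - fst x - b1)"

text \<open>
  Rational maps are modelled as partial maps, with value \<open>None\<close> exactly where some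
  expression in the defining formula (the fraction \<open>P\<close> or its inverse) is undefined.
  Library composition of partial maps (\<open>\<circ>\<^sub>m\<close>) is then defined precisely where every
  intermediate expression is.
\<close>

definition R_map :: "complex \<Rightarrow> complex \<Rightarrow> point \<times> point \<rightharpoonup> point \<times> point" where
  "R_map b1 b2 = (\<lambda>(x, y).
     let P = P_factor b1 b2 x y in
     if snd y - fst x - b1 \<noteq> 0 \<and> P \<noteq> 0
     then Some ((fst y + snd y * (1 - P), snd y * P),
                (fst x - snd y * (1 - P), snd x * inverse P))
     else None)"

definition on12 :: "('a \<times> 'a \<rightharpoonup> 'a \<times> 'a) \<Rightarrow> 'a \<times> 'a \<times> 'a \<rightharpoonup> 'a \<times> 'a \<times> 'a" where
  "on12 f = (\<lambda>(x, y, z). map_option (\<lambda>(p, q). (p, q, z)) (f (x, y)))"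

definition on13 :: "('a \<times> 'a \<rightharpoonup> 'a \<times> 'a) \<Rightarrow> 'a \<times> 'a \<times> 'a \<rightharpoonup> 'a \<times> 'a \<times> 'a" where
  "on13 f = (\<lambda>(x, y, z). map_option (\<lambda>(p, q). (p, y, q)) (f (x, z)))"

definition on23 :: "('a \<times> 'a \<rightharpoonup> 'a \<times> 'a) \<Rightarrow> 'a \<times> 'a \<times> 'a \<rightharpoonup> 'a \<times> 'a \<times> 'a" where
  "on23 f = (\<lambda>(x, y, z). map_option (\<lambda>(p, q). (x, p, q)) (f (y, z)))"

text \<open>
  Equality of rational maps: the two sides agree wherever both are defined. The density
  requirement says that generic points lie in both domains, so that the equality is not
  vacuous.
\<close>

definition rational_eq :: "('a::topological_space \<rightharpoonup> 'b) \<Rightarrow> ('a \<rightharpoonup> 'b) \<Rightarrow> bool" where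
  "rational_eq f g \<longleftrightarrow>
     closure (dom f \<inter> dom g) = UNIV \<and> (\<forall>w \<in> dom f \<inter> dom g. f w = g w)"

end

theory Submission
  imports Defs
begin

text \<open>
  In \<open>R(b1,b2)\<close> the factor \<open>P\<close> depends on the argument only through the scalar
  \<open>s = y\<^sup>2 - x\<^sup>1\<close>, as \<open>P = (s - b2) / (s - b1)\<close>. In part (a) that scalar is
  \<open>u\<^sub>1 + v\<^sub>2\<close>, and the two lattice equations are exactly the statements that \<open>u + v\<^sub>2\<close> is
  multiplied by \<open>P\<close> and \<open>v + u\<^sub>1\<close> by \<open>1 / P\<close>.

  For the Yang-Baxter relation, let \<open>P, Q, T\<close> be the three successive factors on the
  left-hand side and \<open>A, B, C\<close> those on the right-hand side. Comparing the two results entry by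
  entry leaves only \<open>Q = A C\<close>, \<open>B = P T\<close> and one additive relation, all of them identities
  in the three scalars \<open>a = y\<^sup>2 - x\<^sup>1\<close>, \<open>c = z\<^sup>2 - y\<^sup>1\<close> and \<open>y\<^sup>2\<close>
  (lemma \<open>yang_baxter_factors\<close>). The first two hold because both sides reduce to one common
  fraction.

  Equality of rational maps also requires a dense common domain. The map \<open>R\<close> is reversible:
  \<open>R(b1,b2)\<close> sends \<open>(x,y)\<close> to \<open>(p,q)\<close> iff \<open>R(b2,b1)\<close> sends \<open>(q,p)\<close> to \<open>(y,x)\<close>. Hence
  \<open>R\<close> is an open map because it is continuous. Partial maps that are continuous, open and
  densely defined compose (lemma \<open>open_partial_map_comp\<close>), and the lifts of such a map to
  triples are of the same kind, so both threefold products have open dense domains.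
\<close>

section \<open>Densely defined continuous open partial maps\<close>

text \<open>
  Openness is part of the notion because it makes preimages of dense sets dense; density of the
  domain alone would not survive composition.
\<close>

definition open_partial_map :: "('a::topological_space \<rightharpoonup> 'b::topological_space) \<Rightarrow> bool" where
  "open_partial_map f \<longleftrightarrow>
     closure (dom f) = UNIV \<and>
     (\<forall>W. open W \<longrightarrow> open {w. \<exists>v\<in>W. f w = Some v}) \<and>
     (\<forall>U. open U \<longrightarrow> open {v. \<exists>w\<in>U. f w = Some v})"

lemma dense_iff_meets_open:
  "closure S = UNIV \<longleftrightarrow> (\<forall>U. open U \<longrightarrow> U \<noteq> {} \<longrightarrow> U \<inter> S \<noteq> {})"
proof
  assume "closure S = UNIV"
  then show "\<forall>U. open U \<longrightarrow> U \<noteq> {} \<longrightarrow> U \<inter> S \<noteq> {}"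
    using open_Int_closure_eq_empty[of _ S] by auto
next
  assume "\<forall>U. open U \<longrightarrow> U \<noteq> {} \<longrightarrow> U \<inter> S \<noteq> {}"
  then have "- closure S = {}"
    using closure_subset[of S] open_Compl[OF closed_closure[of S]] by blast
  then show "closure S = UNIV" by auto
qed

lemma open_partial_map_meets_dom:
  assumes "open_partial_map f" "open U" "U \<noteq> {}"
  shows "U \<inter> dom f \<noteq> {}"
proof -
  have "closure (dom f) = UNIV" using assms(1) by (simp add: open_partial_map_def)
  with assms(2,3) show ?thesis by (simp add: dense_iff_meets_open)
qed

lemma open_partial_map_open_preimage:
  assumes "open_partial_map f" "open W"
  shows "open {w. \<exists>v\<in>W. f w = Some v}"
  using assms by (simp add: open_partial_map_def)

lemma open_partial_map_open_image:
  assumes "open_partial_map f" "open U"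
  shows "open {v. \<exists>w\<in>U. f w = Some v}"
  using assms by (simp add: open_partial_map_def)

lemma open_dom_open_partial_map:
  assumes "open_partial_map f"
  shows "open (dom f)"
proof -
  have "open {w. \<exists>v\<in>UNIV. f w = Some v}"
    using assms open_UNIV by (rule open_partial_map_open_preimage)
  then show ?thesis by (simp add: dom_def)
qed

text \<open>
  For the density: the image under \<open>g\<close> of a nonempty open set meeting \<open>dom g\<close> is again open
  and nonempty, so it meets the dense set \<open>dom f\<close>.
\<close>

lemma open_partial_map_comp:
  fixes f :: "'b::topological_space \<rightharpoonup> 'c::topological_space"
    and g :: "'a::topological_space \<rightharpoonup> 'b"
  assumes f: "open_partial_map f" and g: "open_partial_map g"
  shows "open_partial_map (f \<circ>\<^sub>m g)"
  unfolding open_partial_map_def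
proof (intro conjI allI impI)
  show "closure (dom (f \<circ>\<^sub>m g)) = UNIV"
    unfolding dense_iff_meets_open
  proof (intro allI impI)
    fix U :: "'a set" assume U: "open U" "U \<noteq> {}"
    have "U \<inter> dom g \<noteq> {}"
      using g U by (rule open_partial_map_meets_dom)
    then have "{v. \<exists>w\<in>U. g w = Some v} \<noteq> {}" by blast
    with f open_partial_map_open_image[OF g U(1)]
    have "{v. \<exists>w\<in>U. g w = Some v} \<inter> dom f \<noteq> {}"
      by (rule open_partial_map_meets_dom)
    then show "U \<inter> dom (f \<circ>\<^sub>m g) \<noteq> {}"
      by (fastforce simp: map_comp_def)
  qed
next
  fix W :: "'c set" assume "open W"
  then have "open {w. \<exists>v\<in>{v. \<exists>t\<in>W. f v = Some t}. g w = Some v}"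
    by (intro open_partial_map_open_preimage f g)
  also have "{w. \<exists>v\<in>{v. \<exists>t\<in>W. f v = Some t}. g w = Some v} = {w. \<exists>t\<in>W. (f \<circ>\<^sub>m g) w = Some t}"
    by (auto simp: map_comp_Some_iff)
  finally show "open {w. \<exists>t\<in>W. (f \<circ>\<^sub>m g) w = Some t}" .
next
  fix U :: "'a set" assume "open U"
  then have "open {t. \<exists>v\<in>{v. \<exists>w\<in>U. g w = Some v}. f v = Some t}"
    by (intro open_partial_map_open_image f g)
  also have "{t. \<exists>v\<in>{v. \<exists>w\<in>U. g w = Some v}. f v = Some t} = {t. \<exists>w\<in>U. (f \<circ>\<^sub>m g) w = Some t}"
    by (auto simp: map_comp_Some_iff)
  finally show "open {t. \<exists>w\<in>U. (f \<circ>\<^sub>m g) w = Some t}" .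
qed

lemma open_partial_map_total:
  assumes h: "homeomorphism UNIV UNIV h k"
  shows "open_partial_map (\<lambda>w. Some (h w))"
  unfolding open_partial_map_def
proof (intro conjI allI impI)
  have ch: "continuous_on UNIV h" and ck: "continuous_on UNIV k"
    and kh: "\<And>w. k (h w) = w" and hk: "\<And>v. h (k v) = v"
    using h by (auto simp: homeomorphism_def)
  have "dom (\<lambda>w. Some (h w)) = UNIV" by auto
  then show "closure (dom (\<lambda>w. Some (h w))) = UNIV" by simp
  {
    fix W :: "'b set" assume "open W"
    then have "open (h -` W)" using ch by (simp add: open_vimage)
    then show "open {w. \<exists>v\<in>W. Some (h w) = Some v}" by (simp add: vimage_def)
  next
    fix U :: "'a set" assume "open U"
    then have "open (k -` U)" using ck by (simp add: open_vimage)
    moreover have "{v. \<exists>w\<in>U. Some (h w) = Some v} = k -` U"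
      using kh hk by force
    ultimately show "open {v. \<exists>w\<in>U. Some (h w) = Some v}" by simp
  }
qed

section \<open>Lifting to triples\<close>

lemma on23_Some_iff:
  "on23 f (x, w) = Some (x', v) \<longleftrightarrow> x' = x \<and> f w = Some v"
  by (cases w; cases v) (auto simp: on23_def)

text \<open>
  Up to the shape of the tuples, \<open>on23 f\<close> is the product of the identity with \<open>f\<close>, so boxes
  suffice to test continuity and openness.
\<close>

lemma open_partial_map_on23:
  fixes f :: "'a::topological_space \<times> 'a \<rightharpoonup> 'a \<times> 'a"
  assumes f: "open_partial_map f"
  shows "open_partial_map (on23 f)"
  unfolding open_partial_map_def
proof (intro conjI allI impI)
  have "dom (on23 f) = UNIV \<times> dom f"
    by (auto simp: on23_def)
  then show "closure (dom (on23 f)) = UNIV"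
    using f by (simp add: closure_Times open_partial_map_def)
next
  fix W :: "('a \<times> 'a \<times> 'a) set" assume W: "open W"
  show "open {w. \<exists>v\<in>W. on23 f w = Some v}"
  proof (rule open_prod_intro, goal_cases)
    case (1 w)
    obtain x y where w: "w = (x, y)" by (cases w)
    then obtain v where v: "(x, v) \<in> W" "f y = Some v"
      using 1 by (auto simp: on23_Some_iff)
    obtain A B where AB: "open A" "open B" "(x, v) \<in> A \<times> B" "A \<times> B \<subseteq> W"
      using open_prod_elim[OF W v(1)] .
    have "open {y. \<exists>v\<in>B. f y = Some v}"
      using f AB(2) by (rule open_partial_map_open_preimage)
    moreover have "w \<in> A \<times> {y. \<exists>v\<in>B. f y = Some v}" using w v AB by auto
    moreover have "A \<times> {y. \<exists>v\<in>B. f y = Some v} \<subseteq> {w. \<exists>v\<in>W. on23 f w = Some v}"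
    proof
      fix t assume "t \<in> A \<times> {y. \<exists>v\<in>B. f y = Some v}"
      then obtain t1 t2 v where t: "t = (t1, t2)" "t1 \<in> A" "v \<in> B" "f t2 = Some v" by auto
      then have "on23 f t = Some (t1, v)" by (simp add: on23_Some_iff)
      moreover have "(t1, v) \<in> W" using t AB(4) by auto
      ultimately show "t \<in> {w. \<exists>v\<in>W. on23 f w = Some v}" by blast
    qed
    ultimately show ?case using AB(1) by (intro exI conjI)
  qed
next
  fix U :: "('a \<times> 'a \<times> 'a) set" assume U: "open U"
  show "open {v. \<exists>w\<in>U. on23 f w = Some v}"
  proof (rule open_prod_intro, goal_cases)
    case (1 v)
    obtain x y where v: "v = (x, y)" by (cases v)
    then obtain w where w: "(x, w) \<in> U" "f w = Some y"
      using 1 by (auto simp: on23_Some_iff)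
    obtain A B where AB: "open A" "open B" "(x, w) \<in> A \<times> B" "A \<times> B \<subseteq> U"
      using open_prod_elim[OF U w(1)] .
    have "open {y. \<exists>w\<in>B. f w = Some y}"
      using f AB(2) by (rule open_partial_map_open_image)
    moreover have "v \<in> A \<times> {y. \<exists>w\<in>B. f w = Some y}" using v w AB by auto
    moreover have "A \<times> {y. \<exists>w\<in>B. f w = Some y} \<subseteq> {v. \<exists>w\<in>U. on23 f w = Some v}"
    proof
      fix t assume "t \<in> A \<times> {y. \<exists>w\<in>B. f w = Some y}"
      then obtain t1 t2 w where t: "t = (t1, t2)" "t1 \<in> A" "w \<in> B" "f w = Some t2" by auto
      then have "on23 f (t1, w) = Some t" by (simp add: on23_Some_iff)
      moreover have "(t1, w) \<in> U" using t AB(4) by auto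
      ultimately show "t \<in> {v. \<exists>w\<in>U. on23 f w = Some v}" by blast
    qed
    ultimately show ?case using AB(1) by (intro exI conjI)
  qed
qed

text \<open>The remaining two lifts are conjugates of \<open>on23\<close> by permutations of the entries.\<close>

lemma open_partial_map_on13:
  fixes f :: "'a::topological_space \<times> 'a \<rightharpoonup> 'a \<times> 'a"
  assumes f: "open_partial_map f"
  shows "open_partial_map (on13 f)"
proof -
  define h :: "'a \<times> 'a \<times> 'a \<Rightarrow> 'a \<times> 'a \<times> 'a" where "h = (\<lambda>w. (fst (snd w), fst w, snd (snd w)))"
  have "homeomorphism UNIV UNIV h h"
    by (rule homeomorphismI) (auto simp: h_def intro!: continuous_intros)
  then have h: "open_partial_map (\<lambda>w. Some (h w))" by (rule open_partial_map_total)
  have "on13 f = (\<lambda>w. Some (h w)) \<circ>\<^sub>m on23 f \<circ>\<^sub>m (\<lambda>w. Some (h w))"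
    by (rule ext) (auto simp: h_def on13_def on23_def map_comp_def split: option.splits)
  then show ?thesis
    using open_partial_map_comp h open_partial_map_on23[OF f] by metis
qed

lemma open_partial_map_on12:
  fixes f :: "'a::topological_space \<times> 'a \<rightharpoonup> 'a \<times> 'a"
  assumes f: "open_partial_map f"
  shows "open_partial_map (on12 f)"
proof -
  define h :: "'a \<times> 'a \<times> 'a \<Rightarrow> 'a \<times> 'a \<times> 'a" where "h = (\<lambda>w. (snd (snd w), fst w, fst (snd w)))"
  define k :: "'a \<times> 'a \<times> 'a \<Rightarrow> 'a \<times> 'a \<times> 'a" where "k = (\<lambda>w. (fst (snd w), snd (snd w), fst w))"
  have hk: "homeomorphism UNIV UNIV h k"
    by (rule homeomorphismI) (auto simp: h_def k_def intro!: continuous_intros)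
  then have h: "open_partial_map (\<lambda>w. Some (h w))" by (rule open_partial_map_total)
  have k: "open_partial_map (\<lambda>w. Some (k w))"
    using hk homeomorphism_symD open_partial_map_total by blast
  have "on12 f = (\<lambda>w. Some (k w)) \<circ>\<^sub>m on23 f \<circ>\<^sub>m (\<lambda>w. Some (h w))"
    by (rule ext) (auto simp: h_def k_def on12_def on23_def map_comp_def split: option.splits)
  then show ?thesis
    using open_partial_map_comp h k open_partial_map_on23[OF f] by metis
qed

section \<open>The map R is a densely defined continuous open map\<close>

lemma R_map_eq:
  "R_map b1 b2 (x, y) =
     (let s = snd y - fst x; P = (s - b2) / (s - b1) in
      if s \<noteq> b1 \<and> s \<noteq> b2
      then Some ((fst y + snd y * (1 - P), snd y * P), (fst x - snd y * (1 - P), snd x / P))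
      else None)"
  by (auto simp: R_map_def P_factor_def Let_def divide_inverse)

text \<open>
  The scalar \<open>s = y\<^sup>2 - x\<^sup>1\<close> equals \<open>p\<^sup>2 - q\<^sup>1\<close>, and exchanging the parameters inverts
  \<open>P\<close>.
\<close>

lemma R_map_reversible_imp:
  assumes "R_map b1 b2 (x, y) = Some (p, q)"
  shows "R_map b2 b1 (q, p) = Some (y, x)"
proof -
  define s where "s = snd y - fst x"
  define P where "P = (s - b2) / (s - b1)"
  have s: "s \<noteq> b1" "s \<noteq> b2"
    and p: "p = (fst y + snd y * (1 - P), snd y * P)"
    and q: "q = (fst x - snd y * (1 - P), snd x / P)"
    using assms by (auto simp: R_map_eq Let_def s_def P_def split: if_splits)
  have P0: "P \<noteq> 0" and P': "(s - b1) / (s - b2) = 1 / P" using s by (auto simp: P_def)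
  have s': "snd p - fst q = s" by (simp add: p q s_def algebra_simps)
  show ?thesis
    unfolding R_map_eq Let_def s' P'
    using s P0 by (auto simp: p q prod_eq_iff field_simps)
qed

lemma R_map_reversible:
  "R_map b1 b2 (x, y) = Some (p, q) \<longleftrightarrow> R_map b2 b1 (q, p) = Some (y, x)"
  using R_map_reversible_imp by blast

lemma open_separated:
  "open {w :: point \<times> point. snd (snd w) - fst (fst w) \<noteq> b1 \<and> snd (snd w) - fst (fst w) \<noteq> b2}"
  by (intro open_Collect_conj open_Collect_neq continuous_intros)

lemma R_map_open_preimage:
  assumes "open W"
  shows "open {w. \<exists>v\<in>W. R_map b1 b2 w = Some v}"
proof -
  define D where
    "D = {w :: point \<times> point. snd (snd w) - fst (fst w) \<noteq> b1 \<and> snd (snd w) - fst (fst w) \<noteq> b2}"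
  define P where
    "P = (\<lambda>w :: point \<times> point. (snd (snd w) - fst (fst w) - b2) / (snd (snd w) - fst (fst w) - b1))"
  define r where
    "r = (\<lambda>w :: point \<times> point.
       ((fst (snd w) + snd (snd w) * (1 - P w), snd (snd w) * P w),
        (fst (fst w) - snd (snd w) * (1 - P w), snd (fst w) / P w)))"
  have "continuous_on D P"
    unfolding P_def by (intro continuous_intros) (auto simp: D_def)
  moreover have "\<forall>w\<in>D. P w \<noteq> 0" by (auto simp: D_def P_def)
  ultimately have "continuous_on D r"
    unfolding r_def by (intro continuous_intros) auto
  then have "open (D \<inter> r -` W)"
    using assms open_separated unfolding D_def by (intro continuous_open_preimage)
  moreover have "R_map b1 b2 w = (if w \<in> D then Some (r w) else None)" for w
    by (cases w) (simp add: R_map_eq D_def r_def P_def Let_def)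
  then have "{w. \<exists>v\<in>W. R_map b1 b2 w = Some v} = D \<inter> r -` W"
    by (auto split: if_splits)
  ultimately show ?thesis by simp
qed

text \<open>
  The domain omits two level sets of the surjective linear form \<open>y\<^sup>2 - x\<^sup>1\<close>, which is an
  open map; images under \<open>R\<close> are preimages under the reversed map.
\<close>

lemma open_partial_map_R_map: "open_partial_map (R_map b1 b2)"
  unfolding open_partial_map_def
proof (intro conjI allI impI)
  show "closure (dom (R_map b1 b2)) = UNIV"
    unfolding dense_iff_meets_open
  proof (intro allI impI)
    fix U :: "(point \<times> point) set" assume U: "open U" "U \<noteq> {}"
    define s where "s = (\<lambda>w :: point \<times> point. snd (snd w) - fst (fst w))"
    have "linear s" by (rule linearI) (auto simp: s_def algebra_simps)
    moreover have "surj s"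
      by (rule surjI[where f = "\<lambda>t. ((0, 0), (0, t))"]) (simp add: s_def)
    ultimately have "open (s ` U)" using U by (intro open_surjective_linear_image)
    then have "\<not> s ` U \<subseteq> {b1, b2}"
      using U finite_imp_not_open[of "s ` U"] finite_subset[of "s ` U" "{b1, b2}"] by auto
    then obtain w where "w \<in> U" "s w \<noteq> b1" "s w \<noteq> b2" by auto
    moreover from this have "w \<in> dom (R_map b1 b2)"
      by (cases w) (auto simp: R_map_eq s_def Let_def)
    ultimately show "U \<inter> dom (R_map b1 b2) \<noteq> {}" by auto
  qed
next
  fix W :: "(point \<times> point) set" assume "open W"
  then show "open {w. \<exists>v\<in>W. R_map b1 b2 w = Some v}" by (rule R_map_open_preimage)
next
  fix U :: "(point \<times> point) set" assume U: "open U"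
  have cs: "continuous_on UNIV (prod.swap :: point \<times> point \<Rightarrow> _)"
    unfolding prod.swap_def by (intro continuous_intros)
  have "open (prod.swap -` U)" using U cs by (simp add: open_vimage)
  then have "open {v. \<exists>w\<in>prod.swap -` U. R_map b2 b1 v = Some w}" by (rule R_map_open_preimage)
  then have "open (prod.swap -` {v. \<exists>w\<in>prod.swap -` U. R_map b2 b1 v = Some w})"
    using cs by (rule open_vimage)
  moreover have "{v. \<exists>w\<in>U. R_map b1 b2 w = Some v} =
      prod.swap -` {v. \<exists>w\<in>prod.swap -` U. R_map b2 b1 v = Some w}"
    by (auto simp: R_map_reversible[of b1 b2] Bex_def split_paired_Ex)
  ultimately show "open {v. \<exists>w\<in>U. R_map b1 b2 w = Some v}" by simp
qed

section \<open>The Yang-Baxter relation\<close>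

text \<open>
  The polynomials \<open>N k\<close> and \<open>M k\<close> below are what remains of the numerators and denominators
  after clearing fractions: \<open>Q\<close> and \<open>A C\<close> both equal \<open>N b3 / N b1\<close>, while \<open>B\<close> and \<open>P T\<close> both equal
  \<open>M b3 / M b1\<close>.
\<close>

lemma yang_baxter_factors:
  fixes a c y b1 b2 b3 s13 s23 t13 t12 P Q T A B C :: complex
  assumes a: "a \<noteq> b1" "a \<noteq> b2" and P: "P = (a - b2) / (a - b1)"
    and s13: "s13 = c - y * (1 - P)" "s13 \<noteq> b1" "s13 \<noteq> b3" and Q: "Q = (s13 - b3) / (s13 - b1)"
    and s23: "s23 = a + y * P * (1 / Q - 1)" "s23 \<noteq> b2" "s23 \<noteq> b3"
    and T: "T = (s23 - b3) / (s23 - b2)"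
    and c: "c \<noteq> b2" "c \<noteq> b3" and A: "A = (c - b3) / (c - b2)"
    and t13: "t13 = a + y * (1 / A - 1)" and B: "B = (t13 - b3) / (t13 - b1)"
    and t12: "t12 = c - y / A * (1 - B)" and C: "C = (t12 - b2) / (t12 - b1)"
  shows "Q = A * C" "B = P * T" "1 - P + P / Q * (1 - T) = (1 - B) / A"
proof -
  define N where "N = (\<lambda>k. (c - k) * (a - b1) - y * (b2 - b1))"
  define M where "M = (\<lambda>k. (a - k) * (c - b3) + y * (b3 - b2))"
  have s13N: "s13 - k = N k / (a - b1)" for k
    using a by (simp add: s13(1) P N_def field_simps)
  have N: "N b1 \<noteq> 0" "N b3 \<noteq> 0" using s13N[of b1] s13N[of b3] s13(2,3) by auto
  have QN: "Q = N b3 / N b1" using a N by (simp add: Q s13N)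
  have "P * (1 / Q - 1) = (a - b2) * (b3 - b1) / N b3"
  proof -
    have "1 / Q - 1 = (N b1 - N b3) / N b3" using N by (simp add: QN diff_divide_distrib)
    also have "N b1 - N b3 = (b3 - b1) * (a - b1)" by (simp add: N_def algebra_simps)
    finally show ?thesis using a by (simp add: P)
  qed
  then have s23': "s23 = a + y * ((a - b2) * (b3 - b1) / N b3)"
    by (simp add: s23(1) mult.assoc)
  have "s23 - b2 = ((a - b2) * N b3 + y * ((a - b2) * (b3 - b1))) / N b3"
    using N by (simp add: s23' field_simps)
  also have "(a - b2) * N b3 + y * ((a - b2) * (b3 - b1)) = (a - b2) * M b1"
    by (simp add: N_def M_def algebra_simps)
  finally have s23b2: "s23 - b2 = (a - b2) * M b1 / N b3" .
  have "s23 - b3 = ((a - b3) * N b3 + y * ((a - b2) * (b3 - b1))) / N b3"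
    using N by (simp add: s23' field_simps)
  also have "(a - b3) * N b3 + y * ((a - b2) * (b3 - b1)) = (a - b1) * M b3"
    by (simp add: N_def M_def algebra_simps)
  finally have s23b3: "s23 - b3 = (a - b1) * M b3 / N b3" .
  have M: "M b1 \<noteq> 0" "M b3 \<noteq> 0" using s23b2 s23b3 s23(2,3) by auto
  have PT: "P * T = M b3 / M b1" using a N M by (simp add: P T s23b2 s23b3)
  have "t13 - k = M k / (c - b3)" for k
    using c by (simp add: t13 A M_def field_simps)
  then have BM: "B = M b3 / M b1" using c M by (simp add: B)
  then show BPT: "B = P * T" using PT by simp
  have "1 - B = (M b1 - M b3) / M b1" using M by (simp add: BM diff_divide_distrib)
  also have "M b1 - M b3 = (b3 - b1) * (c - b3)" by (simp add: M_def algebra_simps)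
  finally have B1: "(1 - B) / A = (c - b2) * (b3 - b1) / M b1" using c by (simp add: A)
  then have t12': "t12 = c - y * ((c - b2) * (b3 - b1) / M b1)"
    unfolding t12 by (simp flip: B1)
  have "t12 - b2 = ((c - b2) * M b1 - y * ((c - b2) * (b3 - b1))) / M b1"
    using M by (simp add: t12' field_simps)
  also have "(c - b2) * M b1 - y * ((c - b2) * (b3 - b1)) = (c - b2) * N b3"
    by (simp add: N_def M_def algebra_simps)
  finally have t12b2: "t12 - b2 = (c - b2) * N b3 / M b1" .
  have "t12 - b1 = ((c - b1) * M b1 - y * ((c - b2) * (b3 - b1))) / M b1"
    using M by (simp add: t12' field_simps)
  also have "(c - b1) * M b1 - y * ((c - b2) * (b3 - b1)) = (c - b3) * N b1"
    by (simp add: N_def M_def algebra_simps)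
  finally have t12b1: "t12 - b1 = (c - b3) * N b1 / M b1" .
  show "Q = A * C" using c M N by (simp add: QN A C t12b1 t12b2)
  have "1 - P + P / Q * (1 - T) = 1 + P * (1 / Q - 1) - B / Q"
    by (simp add: BPT algebra_simps diff_divide_distrib)
  also have "\<dots> = 1 + (a - b2) * (b3 - b1) / N b3 - M b3 * N b1 / (M b1 * N b3)"
    using \<open>P * (1 / Q - 1) = _\<close> by (simp add: BM QN)
  also have "\<dots> = ((N b3 + (a - b2) * (b3 - b1)) * M b1 - M b3 * N b1) / (M b1 * N b3)"
    using M N by (simp add: field_simps)
  also have "(N b3 + (a - b2) * (b3 - b1)) * M b1 - M b3 * N b1 = (c - b2) * (b3 - b1) * N b3"
    by (simp add: N_def M_def algebra_simps)
  also have "(c - b2) * (b3 - b1) * N b3 / (M b1 * N b3) = (1 - B) / A"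
    using N by (simp add: B1)
  finally show "1 - P + P / Q * (1 - T) = (1 - B) / A" .
qed

lemma R_map_SomeD:
  assumes "R_map b1 b2 (x, y) = Some (p, q)"
  obtains s P where "s = snd y - fst x" "s \<noteq> b1" "s \<noteq> b2" "P = (s - b2) / (s - b1)" "P \<noteq> 0"
    "p = (fst y + snd y * (1 - P), snd y * P)" "q = (fst x - snd y * (1 - P), snd x / P)"
  using assms by (auto simp: R_map_eq Let_def split: if_splits)

lemma R_map_yang_baxter:
  assumes l1: "R_map b1 b2 (x, y) = Some (x1, y1)"
    and l2: "R_map b1 b3 (x1, z) = Some (x2, z1)"
    and l3: "R_map b2 b3 (y1, z1) = Some (y2, z2)"
    and r1: "R_map b2 b3 (y, z) = Some (y1', z1')"
    and r2: "R_map b1 b3 (x, z1') = Some (x1', z2')"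
    and r3: "R_map b1 b2 (x1', y1') = Some (x2', y2')"
  shows "x2 = x2'" "y2 = y2'" "z2 = z2'"
proof -
  obtain a P where a: "a = snd y - fst x" "a \<noteq> b1" "a \<noteq> b2" and P: "P = (a - b2) / (a - b1)" "P \<noteq> 0"
    and x1: "x1 = (fst y + snd y * (1 - P), snd y * P)"
    and y1: "y1 = (fst x - snd y * (1 - P), snd x / P)" using R_map_SomeD[OF l1] .
  obtain s13 Q where s13: "s13 = snd z - fst x1" "s13 \<noteq> b1" "s13 \<noteq> b3"
    and Q: "Q = (s13 - b3) / (s13 - b1)" "Q \<noteq> 0"
    and x2: "x2 = (fst z + snd z * (1 - Q), snd z * Q)"
    and z1: "z1 = (fst x1 - snd z * (1 - Q), snd x1 / Q)" using R_map_SomeD[OF l2] .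
  obtain s23 T where s23: "s23 = snd z1 - fst y1" "s23 \<noteq> b2" "s23 \<noteq> b3"
    and T: "T = (s23 - b3) / (s23 - b2)" "T \<noteq> 0"
    and y2: "y2 = (fst z1 + snd z1 * (1 - T), snd z1 * T)"
    and z2: "z2 = (fst y1 - snd z1 * (1 - T), snd y1 / T)" using R_map_SomeD[OF l3] .
  obtain c A where c: "c = snd z - fst y" "c \<noteq> b2" "c \<noteq> b3" and A: "A = (c - b3) / (c - b2)" "A \<noteq> 0"
    and y1': "y1' = (fst z + snd z * (1 - A), snd z * A)"
    and z1': "z1' = (fst y - snd z * (1 - A), snd y / A)" using R_map_SomeD[OF r1] .
  obtain t13 B where t13: "t13 = snd z1' - fst x" and B: "B = (t13 - b3) / (t13 - b1)" "B \<noteq> 0"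
    and x1': "x1' = (fst z1' + snd z1' * (1 - B), snd z1' * B)"
    and z2': "z2' = (fst x - snd z1' * (1 - B), snd x / B)" using R_map_SomeD[OF r2] .
  obtain t12 C where t12: "t12 = snd y1' - fst x1'" and C: "C = (t12 - b2) / (t12 - b1)" "C \<noteq> 0"
    and x2': "x2' = (fst y1' + snd y1' * (1 - C), snd y1' * C)"
    and y2': "y2' = (fst x1' - snd y1' * (1 - C), snd x1' / C)" using R_map_SomeD[OF r3] .
  have e1: "s13 = c - snd y * (1 - P)" by (simp add: s13 x1 c)
  have e2: "s23 = a + snd y * P * (1 / Q - 1)" by (simp add: s23 z1 y1 x1 a algebra_simps)
  have e3: "t13 = a + snd y * (1 / A - 1)" by (simp add: t13 z1' a algebra_simps)
  have e4: "t12 = c - snd y / A * (1 - B)" by (simp add: t12 y1' x1' z1' c algebra_simps)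
  note id = yang_baxter_factors[OF a(2,3) P(1) e1 s13(2,3) Q(1) e2 s23(2,3) T(1) c(2,3) A(1) e3 B(1) e4 C(1)]
  \<comment> \<open>the amount by which the first component of \<open>x\<close> decreases on its way to the third entry\<close>
  have shift: "snd y * (1 - P) + snd y * P / Q * (1 - T) = snd y / A * (1 - B)"
    using arg_cong[OF id(3), of "\<lambda>t. snd y * t"] by (simp add: ring_distribs diff_divide_distrib mult.assoc)
  show "x2 = x2'"
    by (simp add: x2 x2' y1' id(1) algebra_simps)
  have "fst y2 = fst y + (snd y * (1 - P) + snd y * P / Q * (1 - T)) - snd z * (1 - Q)"
    by (simp add: y2 z1 x1)
  also have "\<dots> = fst y2'"
    unfolding shift by (simp add: y2' x1' z1' y1' id(1) algebra_simps)
  finally have "fst y2 = fst y2'" .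
  moreover have "snd y2 = snd y2'"
    by (simp add: y2 y2' z1 x1 x1' z1' id(1,2))
  ultimately show "y2 = y2'" by (simp add: prod_eq_iff)
  have "fst z2 = fst x - (snd y * (1 - P) + snd y * P / Q * (1 - T))"
    by (simp add: z2 y1 z1 x1)
  also have "\<dots> = fst z2'" unfolding shift by (simp add: z2' z1')
  finally have "fst z2 = fst z2'" .
  moreover have "snd z2 = snd z2'" by (simp add: z2 z2' y1 id(2))
  ultimately show "z2 = z2'" by (simp add: prod_eq_iff)
qed

lemma R_map_lattice:
  fixes u v u1 u2 v2 u12 v12 b1 b2 :: complex
  assumes s: "u1 + v2 - b1 \<noteq> 0" "u1 + v2 - b2 \<noteq> 0"
    and u12: "u12 = u + (b1 - b2) * ((u + v2) / (u1 + v2 - b1))"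
    and v12: "v12 = v + (b2 - b1) * ((v + u1) / (u1 + v2 - b2))"
  shows "R_map b1 b2 ((u - u1, v + u1), (u2 - u, u + v2))
           = Some ((u2 - u12, v2 + u12), (u12 - u1, u1 + v12))"
proof -
  define P where "P = (u1 + v2 - b2) / (u1 + v2 - b1)"
  have "P = 1 + (b1 - b2) / (u1 + v2 - b1)" "1 / P = 1 + (b2 - b1) / (u1 + v2 - b2)"
    using s by (simp_all add: P_def field_simps)
  then have "v2 + u12 = (u + v2) * P" "u1 + v12 = (v + u1) * (1 / P)"
    by (simp_all only: u12 v12) (simp_all add: algebra_simps)
  then have e: "u12 = (u + v2) * P - v2" "v12 = (v + u1) / P - u1"
    by (simp_all add: algebra_simps)
  have "R_map b1 b2 ((u - u1, v + u1), (u2 - u, u + v2)) =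
      Some ((u2 - u + (u + v2) * (1 - P), (u + v2) * P),
            (u - u1 - (u + v2) * (1 - P), (v + u1) / P))"
    using s by (simp add: R_map_eq Let_def P_def algebra_simps)
  also have "\<dots> = Some ((u2 - u12, v2 + u12), (u12 - u1, u1 + v12))"
    by (simp add: e algebra_simps)
  finally show ?thesis .
qed

theorem mainTheorem6:
  fixes b1 b2 b3 :: complex
  shows "(\<forall>u v u1 u2 v2 u12 v12 :: complex.
            u1 + v2 - b1 \<noteq> 0 \<longrightarrow> u1 + v2 - b2 \<noteq> 0 \<longrightarrow>
            u12 = u + (b1 - b2) * ((u + v2) / (u1 + v2 - b1)) \<longrightarrow>
            v12 = v + (b2 - b1) * ((v + u1) / (u1 + v2 - b2)) \<longrightarrow>
            R_map b1 b2 ((u - u1, v + u1), (u2 - u, u + v2))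
              = Some ((u2 - u12, v2 + u12), (u12 - u1, u1 + v12)))
       \<and> rational_eq
            (on23 (R_map b2 b3) \<circ>\<^sub>m on13 (R_map b1 b3) \<circ>\<^sub>m on12 (R_map b1 b2))
            (on12 (R_map b1 b2) \<circ>\<^sub>m on13 (R_map b1 b3) \<circ>\<^sub>m on23 (R_map b2 b3))"
proof (intro conjI allI impI, goal_cases)
  case (1 u v u1 u2 v2 u12 v12)
  then show ?case by (rule R_map_lattice)
next
  case 2
  let ?L = "on23 (R_map b2 b3) \<circ>\<^sub>m on13 (R_map b1 b3) \<circ>\<^sub>m on12 (R_map b1 b2)"
  let ?R = "on12 (R_map b1 b2) \<circ>\<^sub>m on13 (R_map b1 b3) \<circ>\<^sub>m on23 (R_map b2 b3)"
  have L: "open_partial_map ?L" and R: "open_partial_map ?R"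
    by (intro open_partial_map_comp open_partial_map_on12 open_partial_map_on13
        open_partial_map_on23 open_partial_map_R_map)+
  show ?case
    unfolding rational_eq_def
  proof (intro conjI ballI)
    have "dom ?L \<subseteq> closure (dom ?L \<inter> dom ?R)"
      using open_Int_closure_subset[OF open_dom_open_partial_map[OF L], of "dom ?R"] R
      by (simp add: open_partial_map_def)
    then have "closure (dom ?L) \<subseteq> closure (dom ?L \<inter> dom ?R)"
      by (rule closure_minimal) simp
    then show "closure (dom ?L \<inter> dom ?R) = UNIV"
      using L by (auto simp: open_partial_map_def)
  next
    fix w assume w: "w \<in> dom ?L \<inter> dom ?R"
    obtain x y z where xyz: "w = (x, y, z)" by (cases w)
    obtain x1 y1 x2 z1 y2 z2 where l: "R_map b1 b2 (x, y) = Some (x1, y1)"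
      "R_map b1 b3 (x1, z) = Some (x2, z1)" "R_map b2 b3 (y1, z1) = Some (y2, z2)"
      using w by (auto simp: xyz map_comp_Some_iff on12_def on13_def on23_def)
    obtain x1' y1' x2' z1' y2' z2' where r: "R_map b2 b3 (y, z) = Some (y1', z1')"
      "R_map b1 b3 (x, z1') = Some (x1', z2')" "R_map b1 b2 (x1', y1') = Some (x2', y2')"
      using w by (auto simp: xyz map_comp_Some_iff on12_def on13_def on23_def)
    have "?L w = Some (x2, y2, z2)" "?R w = Some (x2', y2', z2')"
      by (simp_all add: xyz map_comp_def on12_def on13_def on23_def l r)
    then show "?L w = ?R w" using R_map_yang_baxter[OF l r] by simp
  qed
qed

end
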